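(* Let $(A,R)$ be a modified Rota-Baxter algebra of weight $\kappa\in\mathbf{k}$, and let $(M,S)$ be a bimodule over it. Let $\mathrm{Ext}((A,R),(M,S))$ be the set of isomorphism classes of abelian extensions of $(A,R)$ by the pair $(M,S)$ for which the induced bimodule structure on $(M,S)$ is the given one. Then there is a one-to-one correspondence between $\mathrm{Ext}((A,R),(M,S))$ and the second cohomology group $H^2_{\mathrm{mRBA}}((A,R),(M,S))$.
   Context: Everything is over a field $\mathbf{k}$ of characteristic $0$; algebras are associative (not necessarily unital). A modified Rota-Baxter algebra of weight $\kappa$ is a pair $(A,R)$ of an algebra $A$ and a linear map $R:A\to A$ with $R(a)R(b)=R(R(a)b+aR(b))+\kappa ab$ for all $a,b\in A$. A morphism $(A,R)\to(A',R')$ is an algebra homomorphism $\varphi$ with $R'\circ\varphi=\varphi\circ R$. A bimodule over $(A,R)$ is a pair $(M,S)$ of an $A$-bimodule $M$ and a linear map $S:M\to M$ with $R(a)\cdot S(u)=S(R(a)\cdot u+a\cdot S(u))+\kappa\,a\cdot u$ and $S(u)\cdot R(a)=S(S(u)\cdot a+u\cdot R(a))+\kappa\,u\cdot a$. Abelian extensions. A pair $(M,S)$ of a vector space and a linear endomorphism is regarded as a modified Rota-Baxter algebra of weight $\kappa$ with the zero multiplication on $M$. An abelian extension of $(A,R)$ by $(M,S)$ is a short exact sequence of modified Rota-Baxter algebras of weight $\kappa$, $0\to(M,S)\xrightarrow{i}(E,U)\xrightarrow{\pi}(A,R)\to0$. Two abelian extensions $(E,U)$ (with maps $i,\pi$)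 and $(E',U')$ (with maps $i',\pi'$) are isomorphic if there is an isomorphism $\varphi:(E,U)\to(E',U')$ of modified Rota-Baxter algebras with $\varphi\circ i=i'$ and $\pi'\circ\varphi=\pi$. Given an abelian extension and a linear section $s:A\to E$ of $\pi$, the induced bimodule structure on $(M,S)$ is given by $a\cdot u=s(a)\cdot_Ei(u)$ and $u\cdot a=i(u)\cdot_Es(a)$ (identifying $M$ with $i(M)$); it does not depend on $s$. Cohomology complex. For an algebra $B$ and a $B$-bimodule $N$, $C^n(B,N)=\mathrm{Hom}(B^{\otimes n},N)$ ($C^0=N$) and $(\delta_{\mathrm{Hoch}}f)(b_1,\dots,b_{n+1})=(-1)^{n+1}b_1\cdot f(b_2,\dots,b_{n+1})+f(b_1,\dots,b_n)\cdot b_{n+1}+\sum_{i=1}^n(-1)^{i+n+1}f(b_1,\dots,b_ib_{i+1},\dots,b_{n+1})$. Let $A_R$ be $A$ with the associative product $a*_Rb=R(a)b+aR(b)$, and $\widetilde M$ the $A_R$-bimodule with underlying space $M$, left action $(a,u)\mapsto R(a)\cdot u-S(a\cdot u)$ and right action $(u,a)\mapsto u\cdot R(a)-S(u\cdot a)$; let $\widetilde\delta_{\mathrm{Hoch}}$ be the Hochschild differential of $A_R$ with coefficients in $\widetilde M$, and $\delta_{\mathrm{Hoch}}$ that of $A$ with coefficients in $M$. Let $\Psi^0=\mathrm{id}_M$ and, for $n\ge1$, $\Psi^n(f)(a_1,\dots,a_n)=\sum_{I\subseteq\{1,\dots,n\},\,|I|\text{ even}}(-\kappa)^{|I|/2}f(a^I_1,\dots,a^I_n)-\sum_{I\subseteq\{1,\dots,n\},\,|I|\text{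 odd}}(-\kappa)^{(|I|-1)/2}S\big(f(a^I_1,\dots,a^I_n)\big)$, where $a^I_j=a_j$ if $j\in I$ and $a^I_j=R(a_j)$ if $j\notin I$. The complex has $C^0_{\mathrm{mRBA}}((A,R),(M,S))=M$, $C^n_{\mathrm{mRBA}}((A,R),(M,S))=\mathrm{Hom}(A^{\otimes n},M)\oplus\mathrm{Hom}(A^{\otimes n-1},M)$ for $n\ge1$, with $\delta_{\mathrm{mRBA}}(u)=(\delta_{\mathrm{Hoch}}(u),-u)$ and $\delta_{\mathrm{mRBA}}(\chi,\Phi)=(\delta_{\mathrm{Hoch}}(\chi),-\widetilde\delta_{\mathrm{Hoch}}(\Phi)-\Psi^n(\chi))$. Its cohomology is $H^\bullet_{\mathrm{mRBA}}((A,R),(M,S))$. *)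

theory Defs
  imports Complex_Main "HOL-Library.Function_Algebras" "HOL-Library.Product_Plus"
begin

text \<open>
  Ground field: a type of class \<open>field_char_0\<close>.  The given algebra \<open>A\<close> and the given bimodule \<open>M\<close>
  are types with explicit scalar multiplications (as in \<open>HOL.Vector_Spaces\<close>); \<open>A\<close> has class \<open>ring\<close>,
  which has no unit.  The middle terms of extensions range over a set, so they are structures with
  explicit carriers; \<open>A\<close> and \<open>M\<close> are viewed as such structures by \<open>alg_of\<close> and \<open>null_alg_of\<close>.
\<close>

section \<open>Modified Rota-Baxter algebras\<close>

record ('k, 'e) mrb_struct =
  carrier :: "'e set"
  vzero :: 'e (\<open>\<zero>\<index>\<close>)
  vadd :: "'e \<Rightarrow> 'e \<Rightarrow> 'e" (infixl \<open>\<oplus>\<index>\<close> 65)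
  smul :: "'k \<Rightarrow> 'e \<Rightarrow> 'e" (infixr \<open>\<odot>\<index>\<close> 75)
  vmul :: "'e \<Rightarrow> 'e \<Rightarrow> 'e" (infixl \<open>\<otimes>\<index>\<close> 70)
  rb :: "'e \<Rightarrow> 'e"

locale carrier_vector_space =
  fixes E :: "('k::field_char_0, 'e) mrb_struct" (structure)
  assumes zero_closed: "\<zero> \<in> carrier E"
    and add_closed: "\<lbrakk>x \<in> carrier E; y \<in> carrier E\<rbrakk> \<Longrightarrow> x \<oplus> y \<in> carrier E"
    and add_assoc: "\<lbrakk>x \<in> carrier E; y \<in> carrier E; z \<in> carrier E\<rbrakk> \<Longrightarrow> (x \<oplus> y) \<oplus> z = x \<oplus> (y \<oplus> z)"
    and add_commute: "\<lbrakk>x \<in> carrier E; y \<in> carrier E\<rbrakk> \<Longrightarrow> x \<oplus> y = y \<oplus> x"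
    and add_zero: "x \<in> carrier E \<Longrightarrow> x \<oplus> \<zero> = x"
    and add_inverse: "x \<in> carrier E \<Longrightarrow> \<exists>y\<in>carrier E. x \<oplus> y = \<zero>"
    and smul_closed: "x \<in> carrier E \<Longrightarrow> c \<odot> x \<in> carrier E"
    and smul_add_right: "\<lbrakk>x \<in> carrier E; y \<in> carrier E\<rbrakk> \<Longrightarrow> c \<odot> (x \<oplus> y) = c \<odot> x \<oplus> c \<odot> y"
    and smul_add_left: "x \<in> carrier E \<Longrightarrow> (c + d) \<odot> x = c \<odot> x \<oplus> d \<odot> x"
    and smul_smul: "x \<in> carrier E \<Longrightarrow> c \<odot> (d \<odot> x) = (c * d) \<odot> x"
    and smul_one: "x \<in> carrier E \<Longrightarrow> 1 \<odot> x = x"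

definition linear_on :: "('k, 'e) mrb_struct \<Rightarrow> ('k, 'f) mrb_struct \<Rightarrow> ('e \<Rightarrow> 'f) \<Rightarrow> bool" where
  "linear_on E F \<phi> \<longleftrightarrow>
     (\<forall>x\<in>carrier E. \<phi> x \<in> carrier F) \<and>
     (\<forall>x\<in>carrier E. \<forall>y\<in>carrier E. \<phi> (x \<oplus>\<^bsub>E\<^esub> y) = \<phi> x \<oplus>\<^bsub>F\<^esub> \<phi> y) \<and>
     (\<forall>c. \<forall>x\<in>carrier E. \<phi> (c \<odot>\<^bsub>E\<^esub> x) = c \<odot>\<^bsub>F\<^esub> \<phi> x)"

locale mrb_algebra = carrier_vector_space E
  for \<kappa> :: "'k::field_char_0" and E :: "('k, 'e) mrb_struct" (structure) +
  assumes mul_linear_right: "x \<in> carrier E \<Longrightarrow> linear_on E E (\<lambda>y. x \<otimes> y)"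
    and mul_linear_left: "y \<in> carrier E \<Longrightarrow> linear_on E E (\<lambda>x. x \<otimes> y)"
    and mul_assoc: "\<lbrakk>x \<in> carrier E; y \<in> carrier E; z \<in> carrier E\<rbrakk> \<Longrightarrow> (x \<otimes> y) \<otimes> z = x \<otimes> (y \<otimes> z)"
    and rb_linear: "linear_on E E (rb E)"
    and rb_identity: "\<lbrakk>x \<in> carrier E; y \<in> carrier E\<rbrakk> \<Longrightarrow>
      rb E x \<otimes> rb E y = rb E (rb E x \<otimes> y \<oplus> x \<otimes> rb E y) \<oplus> \<kappa> \<odot> (x \<otimes> y)"

definition mrb_hom :: "('k, 'e) mrb_struct \<Rightarrow> ('k, 'f) mrb_struct \<Rightarrow> ('e \<Rightarrow> 'f) \<Rightarrow> bool" where
  "mrb_hom E F \<phi> \<longleftrightarrow> linear_on E F \<phi> \<and>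
     (\<forall>x\<in>carrier E. \<forall>y\<in>carrier E. \<phi> (x \<otimes>\<^bsub>E\<^esub> y) = \<phi> x \<otimes>\<^bsub>F\<^esub> \<phi> y) \<and>
     (\<forall>x\<in>carrier E. rb F (\<phi> x) = \<phi> (rb E x))"

definition mrb_iso :: "('k, 'e) mrb_struct \<Rightarrow> ('k, 'f) mrb_struct \<Rightarrow> ('e \<Rightarrow> 'f) \<Rightarrow> bool" where
  "mrb_iso E F \<phi> \<longleftrightarrow> mrb_hom E F \<phi> \<and> bij_betw \<phi> (carrier E) (carrier F)"

definition alg_of :: "('k \<Rightarrow> 'a::ring \<Rightarrow> 'a) \<Rightarrow> ('a \<Rightarrow> 'a) \<Rightarrow> ('k, 'a) mrb_struct" where
  "alg_of sA R = \<lparr>carrier = UNIV, vzero = 0, vadd = (+), smul = sA, vmul = (*), rb = R\<rparr>"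

definition null_alg_of ::
    "('k \<Rightarrow> 'm::ab_group_add \<Rightarrow> 'm) \<Rightarrow> ('m \<Rightarrow> 'm) \<Rightarrow> ('k, 'm) mrb_struct" where
  "null_alg_of sM S =
     \<lparr>carrier = UNIV, vzero = 0, vadd = (+), smul = sM, vmul = (\<lambda>_ _. 0), rb = S\<rparr>"


section \<open>Bimodules\<close>

text \<open>Throughout, \<open>l a u\<close> is \<open>a \<cdot> u\<close> and \<open>r u a\<close> is \<open>u \<cdot> a\<close>.\<close>

locale alg_bimodule =
  fixes sA :: "'k::field_char_0 \<Rightarrow> 'a::ring \<Rightarrow> 'a"
    and sM :: "'k \<Rightarrow> 'm::ab_group_add \<Rightarrow> 'm"
    and l :: "'a \<Rightarrow> 'm \<Rightarrow> 'm"
    and r :: "'m \<Rightarrow> 'a \<Rightarrow> 'm"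
  assumes l_linear_M: "Vector_Spaces.linear sM sM (\<lambda>u. l a u)"
    and l_linear_A: "Vector_Spaces.linear sA sM (\<lambda>a. l a u)"
    and r_linear_M: "Vector_Spaces.linear sM sM (\<lambda>u. r u a)"
    and r_linear_A: "Vector_Spaces.linear sA sM (\<lambda>a. r u a)"
    and l_mul: "l (a * b) u = l a (l b u)"
    and r_mul: "r u (a * b) = r (r u a) b"
    and l_r: "r (l a u) b = l a (r u b)"

locale mrb_bimodule = alg_bimodule sA sM l r
  for \<kappa> :: "'k::field_char_0"
    and sA :: "'k \<Rightarrow> 'a::ring \<Rightarrow> 'a" and R :: "'a \<Rightarrow> 'a"
    and sM :: "'k \<Rightarrow> 'm::ab_group_add \<Rightarrow> 'm"
    and l :: "'a \<Rightarrow> 'm \<Rightarrow> 'm" and r :: "'m \<Rightarrow> 'a \<Rightarrow> 'm" and S :: "'m \<Rightarrow> 'm" +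
  assumes S_linear: "Vector_Spaces.linear sM sM S"
    and l_identity: "l (R a) (S u) = S (l (R a) u + l a (S u)) + sM \<kappa> (l a u)"
    and r_identity: "r (S u) (R a) = S (r (S u) a + r u (R a)) + sM \<kappa> (r u a)"


section \<open>Abelian extensions\<close>

type_synonym ('k, 'a, 'm, 'e) extension_data =
  "('k, 'e) mrb_struct \<times> ('m \<Rightarrow> 'e) \<times> ('e \<Rightarrow> 'a)"

definition abelian_extension ::
    "'k::field_char_0 \<Rightarrow> ('k \<Rightarrow> 'a::ring \<Rightarrow> 'a) \<Rightarrow> ('a \<Rightarrow> 'a) \<Rightarrow>
     ('k \<Rightarrow> 'm::ab_group_add \<Rightarrow> 'm) \<Rightarrow> ('m \<Rightarrow> 'm) \<Rightarrow> ('k, 'a, 'm, 'e) extension_data \<Rightarrow> bool" where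
  "abelian_extension \<kappa> sA R sM S = (\<lambda>(E, i, p).
     mrb_algebra \<kappa> E \<and>
     mrb_hom (null_alg_of sM S) E i \<and>
     mrb_hom E (alg_of sA R) p \<and>
     inj i \<and>
     range i = {x \<in> carrier E. p x = 0} \<and>
     p ` carrier E = UNIV)"

definition linear_section ::
    "('k \<Rightarrow> 'a::ring \<Rightarrow> 'a) \<Rightarrow> ('a \<Rightarrow> 'a) \<Rightarrow> ('k, 'a, 'm, 'e) extension_data \<Rightarrow> ('a \<Rightarrow> 'e) \<Rightarrow> bool" where
  "linear_section sA R = (\<lambda>(E, i, p) s. linear_on (alg_of sA R) E s \<and> (\<forall>a. p (s a) = a))"

text \<open>
  Linear sections exist because \<open>'k\<close> is a field, and the induced actions do not depend on the
  section, so asking for some section is the same as asking for all of them.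
\<close>

definition induces_bimodule ::
    "('k \<Rightarrow> 'a::ring \<Rightarrow> 'a) \<Rightarrow> ('a \<Rightarrow> 'a) \<Rightarrow> ('a \<Rightarrow> 'm \<Rightarrow> 'm) \<Rightarrow> ('m \<Rightarrow> 'a \<Rightarrow> 'm) \<Rightarrow>
     ('k, 'a, 'm, 'e) extension_data \<Rightarrow> bool" where
  "induces_bimodule sA R l r = (\<lambda>(E, i, p).
     \<exists>s. linear_section sA R (E, i, p) s \<and>
         (\<forall>a u. i (l a u) = s a \<otimes>\<^bsub>E\<^esub> i u \<and> i (r u a) = i u \<otimes>\<^bsub>E\<^esub> s a))"

definition extensions ::
    "'k::field_char_0 \<Rightarrow> ('k \<Rightarrow> 'a::ring \<Rightarrow> 'a) \<Rightarrow> ('a \<Rightarrow> 'a) \<Rightarrow>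
     ('k \<Rightarrow> 'm::ab_group_add \<Rightarrow> 'm) \<Rightarrow> ('a \<Rightarrow> 'm \<Rightarrow> 'm) \<Rightarrow> ('m \<Rightarrow> 'a \<Rightarrow> 'm) \<Rightarrow> ('m \<Rightarrow> 'm) \<Rightarrow>
     ('k, 'a, 'm, 'e) extension_data set" where
  "extensions \<kappa> sA R sM l r S =
     {X. abelian_extension \<kappa> sA R sM S X \<and> induces_bimodule sA R l r X}"

definition extension_iso ::
    "('k, 'a, 'm, 'e) extension_data \<Rightarrow> ('k, 'a, 'm, 'f) extension_data \<Rightarrow> bool" where
  "extension_iso = (\<lambda>(E, i, p) (E', i', p').
     \<exists>\<phi>. mrb_iso E E' \<phi> \<and> (\<forall>u. \<phi> (i u) = i' u) \<and> (\<forall>x\<in>carrier E. p' (\<phi> x) = p x))"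

text \<open>
  Isomorphism classes of extensions whose middle term has its carrier inside the type \<open>'e\<close>.  A
  middle term is always in bijection with \<open>'a \<times> 'm\<close>, so when \<open>'a \<times> 'm\<close> injects into \<open>'e\<close> every
  abelian extension, over whatever type, is isomorphic to one counted here.
\<close>

definition Ext ::
    "'k::field_char_0 \<Rightarrow> ('k \<Rightarrow> 'a::ring \<Rightarrow> 'a) \<Rightarrow> ('a \<Rightarrow> 'a) \<Rightarrow>
     ('k \<Rightarrow> 'm::ab_group_add \<Rightarrow> 'm) \<Rightarrow> ('a \<Rightarrow> 'm \<Rightarrow> 'm) \<Rightarrow> ('m \<Rightarrow> 'a \<Rightarrow> 'm) \<Rightarrow> ('m \<Rightarrow> 'm) \<Rightarrow>
     ('k, 'a, 'm, 'e) extension_data set set" where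
  "Ext \<kappa> sA R sM l r S =
     extensions \<kappa> sA R sM l r S //
       {(X, Y). X \<in> extensions \<kappa> sA R sM l r S \<and> Y \<in> extensions \<kappa> sA R sM l r S \<and> extension_iso X Y}"


section \<open>Cohomology\<close>

text \<open>
  Elements of \<open>Hom(A\<^sup>\<otimes>\<^sup>n, M)\<close> are the \<open>n\<close>-multilinear maps, encoded as functions on lists that
  vanish off the lists of length \<open>n\<close>.  For \<open>n = 0\<close> such an \<open>f\<close> is just the element \<open>f [] \<in> M\<close>.
\<close>

definition multilinear_maps ::
    "('k::field_char_0 \<Rightarrow> 'a::ab_group_add \<Rightarrow> 'a) \<Rightarrow> ('k \<Rightarrow> 'm::ab_group_add \<Rightarrow> 'm) \<Rightarrow> nat \<Rightarrow>
     ('a list \<Rightarrow> 'm) set" where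
  "multilinear_maps sA sM n =
     {f. (\<forall>as. length as \<noteq> n \<longrightarrow> f as = 0) \<and>
         (\<forall>as j. length as = n \<longrightarrow> j < n \<longrightarrow> Vector_Spaces.linear sA sM (\<lambda>a. f (as[j := a])))}"

text \<open>\<open>merge mul i [b\<^sub>1, \<dots>, b\<^sub>m] = [b\<^sub>1, \<dots>, mul b\<^sub>i b\<^sub>i\<^sub>+\<^sub>1, \<dots>, b\<^sub>m]\<close>, with \<open>i\<close> counted from 1.\<close>

definition merge :: "('a \<Rightarrow> 'a \<Rightarrow> 'a) \<Rightarrow> nat \<Rightarrow> 'a list \<Rightarrow> 'a list" where
  "merge mul i bs = take (i - 1) bs @ [mul (bs ! (i - 1)) (bs ! i)] @ drop (i + 1) bs"

definition hoch ::
    "('k::field_char_0 \<Rightarrow> 'm::ab_group_add \<Rightarrow> 'm) \<Rightarrow> ('a \<Rightarrow> 'a \<Rightarrow> 'a) \<Rightarrow> ('a \<Rightarrow> 'm \<Rightarrow> 'm) \<Rightarrow>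
     ('m \<Rightarrow> 'a \<Rightarrow> 'm) \<Rightarrow> nat \<Rightarrow> ('a list \<Rightarrow> 'm) \<Rightarrow> 'a list \<Rightarrow> 'm" where
  "hoch sM mul l r n f = (\<lambda>bs.
     if length bs = n + 1
     then sM ((- 1) ^ (n + 1)) (l (hd bs) (f (tl bs))) + r (f (butlast bs)) (last bs)
          + (\<Sum>i = 1..n. sM ((- 1) ^ (i + n + 1)) (f (merge mul i bs)))
     else 0)"

definition mul_R :: "('a::ring \<Rightarrow> 'a) \<Rightarrow> 'a \<Rightarrow> 'a \<Rightarrow> 'a" where
  "mul_R R a b = R a * b + a * R b"

definition l_tilde ::
    "('a \<Rightarrow> 'a) \<Rightarrow> ('a \<Rightarrow> 'm::ab_group_add \<Rightarrow> 'm) \<Rightarrow> ('m \<Rightarrow> 'm) \<Rightarrow> 'a \<Rightarrow> 'm \<Rightarrow> 'm" where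
  "l_tilde R l S a u = l (R a) u - S (l a u)"

definition r_tilde ::
    "('a \<Rightarrow> 'a) \<Rightarrow> ('m::ab_group_add \<Rightarrow> 'a \<Rightarrow> 'm) \<Rightarrow> ('m \<Rightarrow> 'm) \<Rightarrow> 'm \<Rightarrow> 'a \<Rightarrow> 'm" where
  "r_tilde R r S u a = r u (R a) - S (r u a)"

text \<open>\<open>twist R I [a\<^sub>0, \<dots>, a\<^sub>n\<^sub>-\<^sub>1]\<close> is \<open>(a\<^sup>I\<^sub>0, \<dots>, a\<^sup>I\<^sub>n\<^sub>-\<^sub>1)\<close>; positions are counted from 0.\<close>

definition twist :: "('a \<Rightarrow> 'a) \<Rightarrow> nat set \<Rightarrow> 'a list \<Rightarrow> 'a list" where
  "twist R I as = map (\<lambda>j. if j \<in> I then as ! j else R (as ! j)) [0..<length as]"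

definition Psi ::
    "'k::field_char_0 \<Rightarrow> ('a \<Rightarrow> 'a) \<Rightarrow> ('k \<Rightarrow> 'm::ab_group_add \<Rightarrow> 'm) \<Rightarrow> ('m \<Rightarrow> 'm) \<Rightarrow> nat \<Rightarrow>
     ('a list \<Rightarrow> 'm) \<Rightarrow> 'a list \<Rightarrow> 'm" where
  "Psi \<kappa> R sM S n f = (if n = 0 then f else (\<lambda>as.
     if length as = n
     then (\<Sum>I | I \<subseteq> {..<n} \<and> even (card I). sM ((- \<kappa>) ^ (card I div 2)) (f (twist R I as)))
        - (\<Sum>I | I \<subseteq> {..<n} \<and> odd (card I). sM ((- \<kappa>) ^ ((card I - 1) div 2)) (S (f (twist R I as))))
     else 0))"

text \<open>In degree 0 an element \<open>u\<close> of \<open>M\<close> is encoded as a pair with second component 0.\<close>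

definition mrba_cochains ::
    "('k::field_char_0 \<Rightarrow> 'a::ring \<Rightarrow> 'a) \<Rightarrow> ('k \<Rightarrow> 'm::ab_group_add \<Rightarrow> 'm) \<Rightarrow> nat \<Rightarrow>
     (('a list \<Rightarrow> 'm) \<times> ('a list \<Rightarrow> 'm)) set" where
  "mrba_cochains sA sM n =
     multilinear_maps sA sM n \<times> (if n = 0 then {0} else multilinear_maps sA sM (n - 1))"

definition mrba_diff ::
    "'k::field_char_0 \<Rightarrow> ('a::ring \<Rightarrow> 'a) \<Rightarrow>
     ('k \<Rightarrow> 'm::ab_group_add \<Rightarrow> 'm) \<Rightarrow> ('a \<Rightarrow> 'm \<Rightarrow> 'm) \<Rightarrow> ('m \<Rightarrow> 'a \<Rightarrow> 'm) \<Rightarrow> ('m \<Rightarrow> 'm) \<Rightarrow> nat \<Rightarrow>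
     ('a list \<Rightarrow> 'm) \<times> ('a list \<Rightarrow> 'm) \<Rightarrow> ('a list \<Rightarrow> 'm) \<times> ('a list \<Rightarrow> 'm)" where
  "mrba_diff \<kappa> R sM l r S n = (\<lambda>(\<chi>, \<Phi>).
     (hoch sM (*) l r n \<chi>,
      if n = 0 then - \<chi>
      else - hoch sM (mul_R R) (l_tilde R l S) (r_tilde R r S) (n - 1) \<Phi> - Psi \<kappa> R sM S n \<chi>))"

definition mrba_cocycles ::
    "'k::field_char_0 \<Rightarrow> ('k \<Rightarrow> 'a::ring \<Rightarrow> 'a) \<Rightarrow> ('a \<Rightarrow> 'a) \<Rightarrow>
     ('k \<Rightarrow> 'm::ab_group_add \<Rightarrow> 'm) \<Rightarrow> ('a \<Rightarrow> 'm \<Rightarrow> 'm) \<Rightarrow> ('m \<Rightarrow> 'a \<Rightarrow> 'm) \<Rightarrow> ('m \<Rightarrow> 'm) \<Rightarrow> nat \<Rightarrow>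
     (('a list \<Rightarrow> 'm) \<times> ('a list \<Rightarrow> 'm)) set" where
  "mrba_cocycles \<kappa> sA R sM l r S n = {c \<in> mrba_cochains sA sM n. mrba_diff \<kappa> R sM l r S n c = 0}"

definition mrba_coboundaries ::
    "'k::field_char_0 \<Rightarrow> ('k \<Rightarrow> 'a::ring \<Rightarrow> 'a) \<Rightarrow> ('a \<Rightarrow> 'a) \<Rightarrow>
     ('k \<Rightarrow> 'm::ab_group_add \<Rightarrow> 'm) \<Rightarrow> ('a \<Rightarrow> 'm \<Rightarrow> 'm) \<Rightarrow> ('m \<Rightarrow> 'a \<Rightarrow> 'm) \<Rightarrow> ('m \<Rightarrow> 'm) \<Rightarrow> nat \<Rightarrow>
     (('a list \<Rightarrow> 'm) \<times> ('a list \<Rightarrow> 'm)) set" where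
  "mrba_coboundaries \<kappa> sA R sM l r S n =
     (if n = 0 then {0} else mrba_diff \<kappa> R sM l r S (n - 1) ` mrba_cochains sA sM (n - 1))"

definition mrba_cohomology ::
    "'k::field_char_0 \<Rightarrow> ('k \<Rightarrow> 'a::ring \<Rightarrow> 'a) \<Rightarrow> ('a \<Rightarrow> 'a) \<Rightarrow>
     ('k \<Rightarrow> 'm::ab_group_add \<Rightarrow> 'm) \<Rightarrow> ('a \<Rightarrow> 'm \<Rightarrow> 'm) \<Rightarrow> ('m \<Rightarrow> 'a \<Rightarrow> 'm) \<Rightarrow> ('m \<Rightarrow> 'm) \<Rightarrow> nat \<Rightarrow>
     (('a list \<Rightarrow> 'm) \<times> ('a list \<Rightarrow> 'm)) set set" where
  "mrba_cohomology \<kappa> sA R sM l r S n =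
     mrba_cocycles \<kappa> sA R sM l r S n //
       {(c, c'). c \<in> mrba_cocycles \<kappa> sA R sM l r S n \<and> c' \<in> mrba_cocycles \<kappa> sA R sM l r S n \<and>
                 c - c' \<in> mrba_coboundaries \<kappa> sA R sM l r S n}"

end

theory Submission imports Defs begin

text \<open>
  A linear section \<open>s\<close> of an abelian extension identifies its middle term with \<open>A \<times> M\<close> through
  \<open>(a, u) \<mapsto> s a + i u\<close>.  The failure of \<open>s\<close> to be multiplicative and to commute with the operators
  is a pair \<open>(\<chi>, \<Phi>)\<close>, and the structure transported to \<open>A \<times> M\<close> is
  \<open>(a, u) (b, v) = (a b, a \<cdot> v + u \<cdot> b + \<chi>(a, b))\<close>, \<open>U (a, u) = (R a, S u + \<Phi> a)\<close>.  Associativity and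
  the modified Rota-Baxter identity for it say precisely that \<open>(\<chi>, \<Phi>)\<close> is a 2-cocycle.  An
  isomorphism between two such extensions must have the form \<open>(a, u) \<mapsto> (a, u + \<psi> a)\<close>, and it
  respects the structures precisely when the cocycles differ by the coboundary of \<open>(\<psi>, 0)\<close>; every
  2-coboundary arises in this way.
\<close>

section \<open>Bijections between quotient sets\<close>

text \<open>Sending a class to everything in the other set that \<open>P\<close> relates to one of
  its members gives maps in both directions. By \<open>P_iff\<close>, the class of \<open>x\<close>
  goes to the class of any \<open>y\<close> with \<open>P x y\<close>, and back, so the two maps are
  mutually inverse and no representatives have to be chosen.\<close>

lemma ex_bij_betw_quotients:
  assumes AB: "\<And>x. x \<in> A \<Longrightarrow> \<exists>y\<in>B. P x y"
    and BA: "\<And>y. y \<in> B \<Longrightarrow> \<exists>x\<in>A. P x y"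
    and P_iff: "\<And>x x' y y'. \<lbrakk>x \<in> A; x' \<in> A; y \<in> B; y' \<in> B; P x y; P x' y'\<rbrakk> \<Longrightarrow>
      (x, x') \<in> rA \<longleftrightarrow> (y, y') \<in> rB"
    and "rA \<subseteq> A \<times> A" "rB \<subseteq> B \<times> B"
  shows "\<exists>F. bij_betw F (A // rA) (B // rB)"
proof -
  define F where "F X = {y \<in> B. \<exists>x\<in>X. P x y}" for X
  define G where "G Y = {x \<in> A. \<exists>y\<in>Y. P x y}" for Y
  have F: "F (rA `` {x}) = rB `` {y}" if "x \<in> A" "y \<in> B" "P x y" for x y
  proof (intro equalityI subsetI)
    fix z assume "z \<in> F (rA `` {x})"
    then obtain x' where "(x, x') \<in> rA" "z \<in> B" "P x' z"
      unfolding F_def by blast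
    then show "z \<in> rB `` {y}"
      using P_iff[of x x' y z] that \<open>rA \<subseteq> A \<times> A\<close> by blast
  next
    fix z assume "z \<in> rB `` {y}"
    then have "(y, z) \<in> rB" "z \<in> B"
      using \<open>rB \<subseteq> B \<times> B\<close> by auto
    moreover obtain x' where "x' \<in> A" "P x' z"
      using BA \<open>z \<in> B\<close> by blast
    ultimately show "z \<in> F (rA `` {x})"
      using P_iff[of x x' y z] that unfolding F_def by blast
  qed
  have G: "G (rB `` {y}) = rA `` {x}" if "x \<in> A" "y \<in> B" "P x y" for x y
  proof (intro equalityI subsetI)
    fix z assume "z \<in> G (rB `` {y})"
    then obtain y' where "(y, y') \<in> rB" "z \<in> A" "P z y'"
      unfolding G_def by blast
    then show "z \<in> rA `` {x}"
      using P_iff[of x z y y'] that \<open>rB \<subseteq> B \<times> B\<close> by blast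
  next
    fix z assume "z \<in> rA `` {x}"
    then have "(x, z) \<in> rA" "z \<in> A"
      using \<open>rA \<subseteq> A \<times> A\<close> by auto
    moreover obtain y' where "y' \<in> B" "P z y'"
      using AB \<open>z \<in> A\<close> by blast
    ultimately show "z \<in> G (rB `` {y})"
      using P_iff[of x z y y'] that unfolding G_def by blast
  qed
  have "\<exists>Y\<in>B // rB. F X = Y \<and> G Y = X" if "X \<in> A // rA" for X
  proof -
    obtain x where x: "x \<in> A" "X = rA `` {x}"
      using \<open>X \<in> A // rA\<close> by (auto elim: quotientE)
    obtain y where "y \<in> B" "P x y"
      using AB x by blast
    then show ?thesis
      using x F G by (auto intro!: quotientI)
  qed
  moreover have "\<exists>X\<in>A // rA. G Y = X \<and> F X = Y" if "Y \<in> B // rB" for Y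
  proof -
    obtain y where y: "y \<in> B" "Y = rB `` {y}"
      using \<open>Y \<in> B // rB\<close> by (auto elim: quotientE)
    obtain x where "x \<in> A" "P x y"
      using BA y by blast
    then show ?thesis
      using y F G by (auto intro!: quotientI)
  qed
  ultimately have "bij_betw F (A // rA) (B // rB)"
    by (intro bij_betw_byWitness[where f' = G]) auto
  then show ?thesis by (rule exI[of _ F])
qed

section \<open>Carrier structures and isomorphisms of algebras and extensions\<close>

context carrier_vector_space
begin

lemma add_left_commute:
  assumes "x \<in> carrier E" "y \<in> carrier E" "z \<in> carrier E"
  shows "x \<oplus> (y \<oplus> z) = y \<oplus> (x \<oplus> z)"
  using assms by (metis add_assoc add_commute)

lemma add_left_cancel:
  assumes "x \<in> carrier E" "y \<in> carrier E" "z \<in> carrier E"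
  shows "x \<oplus> y = x \<oplus> z \<longleftrightarrow> y = z"
  using assms by (metis add_assoc add_commute add_inverse add_zero)

lemma smul_zero:
  assumes "x \<in> carrier E"
  shows "0 \<odot> x = \<zero>"
  using assms smul_add_left[OF assms, of 0 0] add_left_cancel[of "0 \<odot> x" "0 \<odot> x" \<zero>]
  by (simp add: smul_closed zero_closed add_zero)

end

lemma mrb_isoD:
  assumes "mrb_iso E F \<phi>"
  shows "x \<in> carrier E \<Longrightarrow> \<phi> x \<in> carrier F"
    and "\<lbrakk>x \<in> carrier E; y \<in> carrier E\<rbrakk> \<Longrightarrow> \<phi> (x \<oplus>\<^bsub>E\<^esub> y) = \<phi> x \<oplus>\<^bsub>F\<^esub> \<phi> y"
    and "x \<in> carrier E \<Longrightarrow> \<phi> (c \<odot>\<^bsub>E\<^esub> x) = c \<odot>\<^bsub>F\<^esub> \<phi> x"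
    and "\<lbrakk>x \<in> carrier E; y \<in> carrier E\<rbrakk> \<Longrightarrow> \<phi> (x \<otimes>\<^bsub>E\<^esub> y) = \<phi> x \<otimes>\<^bsub>F\<^esub> \<phi> y"
    and "x \<in> carrier E \<Longrightarrow> rb F (\<phi> x) = \<phi> (rb E x)"
    and "bij_betw \<phi> (carrier E) (carrier F)"
  using assms unfolding mrb_iso_def mrb_hom_def linear_on_def by auto

lemma (in mrb_algebra) closed:
  shows "\<lbrakk>x \<in> carrier E; y \<in> carrier E\<rbrakk> \<Longrightarrow> x \<otimes> y \<in> carrier E"
    and "x \<in> carrier E \<Longrightarrow> rb E x \<in> carrier E"
  using mul_linear_right rb_linear unfolding linear_on_def by auto

lemma (in mrb_algebra) mrb_iso_inv_into:
  assumes "mrb_iso E F \<phi>"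
  shows "mrb_iso F E (inv_into (carrier E) \<phi>)"
proof -
  note iso = mrb_isoD[OF assms]
  have inj: "inj_on \<phi> (carrier E)" and img: "carrier F = \<phi> ` carrier E"
    using iso(6) by (auto simp: bij_betw_def)
  have [simp]: "inv_into (carrier E) \<phi> (\<phi> x) = x" if "x \<in> carrier E" for x
    using inv_into_f_f[OF inj that] .
  \<comment> \<open>Every element of \<open>carrier F\<close> is some \<open>\<phi> x\<close>. The
    homomorphism equations pull the operations of \<open>F\<close> inside \<open>\<phi>\<close>,
    where the inverse cancels it, because \<open>E\<close> is closed under its operations.\<close>
  show ?thesis
    unfolding mrb_iso_def mrb_hom_def linear_on_def
    using bij_betw_inv_into[OF iso(6)]
    by (auto simp: img iso(2-4)[symmetric] iso(5) add_closed smul_closed closed)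
qed

lemma mrb_iso_comp:
  assumes "mrb_iso E F \<phi>" "mrb_iso F G \<psi>"
  shows "mrb_iso E G (\<psi> \<circ> \<phi>)"
  using mrb_isoD[OF assms(1)] mrb_isoD[OF assms(2)]
  unfolding mrb_iso_def mrb_hom_def linear_on_def by (auto intro: bij_betw_trans)

lemma extension_iso_refl: "extension_iso X X"
  by (cases X) (auto simp: extension_iso_def mrb_iso_def mrb_hom_def linear_on_def bij_betw_def
      intro!: exI[of _ "\<lambda>x. x"])

text \<open>The hypothesis on \<open>X\<close> supplies the closure of its middle term, which makes
  the inverse map a homomorphism, and puts \<open>i u\<close> into the carrier, so that the inverse
  takes \<open>i' u\<close> back to \<open>i u\<close>. What is needed about \<open>Y\<close> is
  transported along \<open>\<phi>\<close>.\<close>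

lemma extension_iso_sym:
  assumes "abelian_extension \<kappa> sA R sM S X" "extension_iso X Y"
  shows "extension_iso Y X"
proof -
  obtain E i p E' i' p' where X: "X = (E, i, p)" and Y: "Y = (E', i', p')"
    by (cases X, cases Y) auto
  interpret mrb_algebra \<kappa> E
    using assms by (simp add: X abelian_extension_def)
  obtain \<phi> where iso: "mrb_iso E E' \<phi>" and i: "\<And>u. \<phi> (i u) = i' u"
    and p: "\<And>x. x \<in> carrier E \<Longrightarrow> p' (\<phi> x) = p x"
    using assms(2) by (auto simp: X Y extension_iso_def)
  have inj: "inj_on \<phi> (carrier E)" and img: "carrier E' = \<phi> ` carrier E"
    using mrb_isoD(6)[OF iso] by (auto simp: bij_betw_def)
  have [simp]: "inv_into (carrier E) \<phi> (\<phi> x) = x" if "x \<in> carrier E" for x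
    using inv_into_f_f[OF inj that] .
  have "i u \<in> carrier E" for u
    using assms(1) by (auto simp: X abelian_extension_def)
  then show ?thesis
    using mrb_iso_inv_into[OF iso]
    by (auto simp: X Y extension_iso_def img p i[symmetric]
        intro!: exI[of _ "inv_into (carrier E) \<phi>"])
qed

lemma extension_iso_trans:
  assumes "extension_iso X Y" "extension_iso Y Z"
  shows "extension_iso X Z"
proof -
  obtain E i p E' i' p' E'' i'' p''
    where eqs: "X = (E, i, p)" "Y = (E', i', p')" "Z = (E'', i'', p'')"
    by (cases X, cases Y, cases Z) auto
  obtain \<phi> \<psi> where "mrb_iso E E' \<phi>" "\<And>u. \<phi> (i u) = i' u"
    "\<And>x. x \<in> carrier E \<Longrightarrow> p' (\<phi> x) = p x"
    and "mrb_iso E' E'' \<psi>" "\<And>u. \<psi> (i' u) = i'' u"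
    "\<And>x. x \<in> carrier E' \<Longrightarrow> p'' (\<psi> x) = p' x"
    using assms by (auto simp: eqs extension_iso_def)
  then show ?thesis
    using mrb_iso_comp[of E E' \<phi> E'' \<psi>] mrb_isoD(1)[of E E' \<phi>]
    by (auto simp: eqs extension_iso_def intro!: exI[of _ "\<psi> \<circ> \<phi>"])
qed

text \<open>An injective homomorphism reflects equations, so each identity of \<open>E\<close>
  follows from the same identity in \<open>F\<close>. This will show that a twisted structure is an
  algebra before its cochain is known to be a cocycle.\<close>

lemma mrb_algebra_pullback:
  fixes E :: "('k::field_char_0, 'e) mrb_struct" and F :: "('k, 'f) mrb_struct"
  assumes "carrier_vector_space E" "mrb_algebra \<kappa> F" "mrb_hom E F \<phi>" "inj_on \<phi> (carrier E)"
    and mul_closed: "\<And>x y. \<lbrakk>x \<in> carrier E; y \<in> carrier E\<rbrakk> \<Longrightarrow> x \<otimes>\<^bsub>E\<^esub> y \<in> carrier E"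
    and rb_closed: "\<And>x. x \<in> carrier E \<Longrightarrow> rb E x \<in> carrier E"
  shows "mrb_algebra \<kappa> E"
proof -
  interpret E: carrier_vector_space E by fact
  interpret F: mrb_algebra \<kappa> F by fact
  have hom: "\<And>x. x \<in> carrier E \<Longrightarrow> \<phi> x \<in> carrier F"
    "\<And>x y. \<lbrakk>x \<in> carrier E; y \<in> carrier E\<rbrakk> \<Longrightarrow> \<phi> (x \<oplus>\<^bsub>E\<^esub> y) = \<phi> x \<oplus>\<^bsub>F\<^esub> \<phi> y"
    "\<And>c x. x \<in> carrier E \<Longrightarrow> \<phi> (c \<odot>\<^bsub>E\<^esub> x) = c \<odot>\<^bsub>F\<^esub> \<phi> x"
    "\<And>x y. \<lbrakk>x \<in> carrier E; y \<in> carrier E\<rbrakk> \<Longrightarrow> \<phi> (x \<otimes>\<^bsub>E\<^esub> y) = \<phi> x \<otimes>\<^bsub>F\<^esub> \<phi> y"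
    "\<And>x. x \<in> carrier E \<Longrightarrow> \<phi> (rb E x) = rb F (\<phi> x)"
    using assms(3) unfolding mrb_hom_def linear_on_def by auto
  have inj: "x = y" if "\<phi> x = \<phi> y" "x \<in> carrier E" "y \<in> carrier E" for x y
    using that assms(4) by (auto dest: inj_onD)
  note closed = mul_closed rb_closed E.add_closed E.smul_closed
  show ?thesis
    using F.mul_linear_right F.mul_linear_left F.rb_linear
    unfolding linear_on_def
    by unfold_locales
      (auto simp: linear_on_def closed hom F.mul_assoc F.rb_identity intro!: inj)
qed


section \<open>Multilinear maps in one and two arguments\<close>

lemma length_2_iff: "length xs = 2 \<longleftrightarrow> (\<exists>a b. xs = [a, b])"
  by (auto simp: numeral_2_eq_2 length_Suc_conv)

lemma length_3_iff: "length xs = 3 \<longleftrightarrow> (\<exists>a b c. xs = [a, b, c])"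
  by (auto simp: numeral_3_eq_3 length_Suc_conv)

lemma multilinear_maps_1_iff:
  "f \<in> multilinear_maps sA sM (Suc 0) \<longleftrightarrow>
    (\<forall>as. length as \<noteq> Suc 0 \<longrightarrow> f as = 0) \<and> Vector_Spaces.linear sA sM (\<lambda>a. f [a])"
  by (auto simp: multilinear_maps_def length_Suc_conv)

lemma multilinear_maps_2_iff:
  "f \<in> multilinear_maps sA sM 2 \<longleftrightarrow>
    (\<forall>as. length as \<noteq> 2 \<longrightarrow> f as = 0) \<and>
    (\<forall>b. Vector_Spaces.linear sA sM (\<lambda>a. f [a, b])) \<and>
    (\<forall>a. Vector_Spaces.linear sA sM (\<lambda>b. f [a, b]))"
proof -
  have "(\<forall>as j. length as = 2 \<longrightarrow> j < 2 \<longrightarrow> Vector_Spaces.linear sA sM (\<lambda>a. f (as[j := a]))) \<longleftrightarrow>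
    (\<forall>b. Vector_Spaces.linear sA sM (\<lambda>a. f [a, b])) \<and>
    (\<forall>a. Vector_Spaces.linear sA sM (\<lambda>b. f [a, b]))"
  proof (intro iffI conjI allI impI)
    fix a b
    assume *: "\<forall>as j. length as = 2 \<longrightarrow> j < 2 \<longrightarrow> Vector_Spaces.linear sA sM (\<lambda>a. f (as[j := a]))"
    show "Vector_Spaces.linear sA sM (\<lambda>a. f [a, b])"
      \<comment> \<open>The entry at the updated position is overwritten, so any list with
        \<open>b\<close> in the other place would do.\<close>
      using *[rule_format, of "[b, b]" 0] by simp
    show "Vector_Spaces.linear sA sM (\<lambda>b. f [a, b])"
      using *[rule_format, of "[a, a]" 1] by simp
  qed (auto simp: length_2_iff less_2_cases_iff)
  then show ?thesis
    by (simp add: multilinear_maps_def)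
qed

text \<open>
  The extension of a cocycle lives on \<open>A \<times> M\<close>, moved into the type of the middle terms along an
  injection \<open>\<iota>\<close>; its operations have no meaning outside the range of \<open>\<iota>\<close>.
\<close>

definition twisted_extension ::
    "('a \<times> 'm \<Rightarrow> 'e) \<Rightarrow> ('k \<Rightarrow> 'a::ring \<Rightarrow> 'a) \<Rightarrow> ('a \<Rightarrow> 'a) \<Rightarrow>
     ('k \<Rightarrow> 'm::ab_group_add \<Rightarrow> 'm) \<Rightarrow> ('a \<Rightarrow> 'm \<Rightarrow> 'm) \<Rightarrow> ('m \<Rightarrow> 'a \<Rightarrow> 'm) \<Rightarrow> ('m \<Rightarrow> 'm) \<Rightarrow>
     ('a list \<Rightarrow> 'm) \<times> ('a list \<Rightarrow> 'm) \<Rightarrow> ('k, 'a, 'm, 'e) extension_data" where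
  "twisted_extension \<iota> sA R sM l r S = (\<lambda>(\<chi>, \<Phi>).
     (\<lparr>carrier = range \<iota>,
       vzero = \<iota> (0, 0),
       vadd = (\<lambda>x y. \<iota> (inv \<iota> x + inv \<iota> y)),
       smul = (\<lambda>c x. case inv \<iota> x of (a, u) \<Rightarrow> \<iota> (sA c a, sM c u)),
       vmul = (\<lambda>x y. case (inv \<iota> x, inv \<iota> y) of
         ((a, u), (b, v)) \<Rightarrow> \<iota> (a * b, l a v + r u b + \<chi> [a, b])),
       rb = (\<lambda>x. case inv \<iota> x of (a, u) \<Rightarrow> \<iota> (R a, S u + \<Phi> [a]))\<rparr>,
      \<lambda>u. \<iota> (0, u), \<lambda>x. fst (inv \<iota> x)))"

section \<open>The given algebra and bimodule\<close>

locale mrb_algebra_with_bimodule = mrb_bimodule \<kappa> sA R sM l r S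
  for \<kappa> :: "'k::field_char_0"
    and sA :: "'k \<Rightarrow> 'a::ring \<Rightarrow> 'a" and R :: "'a \<Rightarrow> 'a"
    and sM :: "'k \<Rightarrow> 'm::ab_group_add \<Rightarrow> 'm"
    and l :: "'a \<Rightarrow> 'm \<Rightarrow> 'm" and r :: "'m \<Rightarrow> 'a \<Rightarrow> 'm" and S :: "'m \<Rightarrow> 'm" +
  fixes \<iota> :: "'a \<times> 'm \<Rightarrow> 'e"
  assumes mrb_algebra_A: "mrb_algebra \<kappa> (alg_of sA R)"
    and inj_emb: "inj \<iota>"
begin

text \<open>\<open>Vector_Spaces.linear\<close> includes the vector space axioms for both scalings,
  so the linearity of a single action map provides them for \<open>A\<close> and for
  \<open>M\<close>.\<close>

sublocale A: vector_space sA
  using l_linear_A[of 0] by (simp add: Vector_Spaces.linear_def)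

sublocale M: vector_space sM
  using l_linear_A[of 0] by (simp add: Vector_Spaces.linear_def)

lemma R_simps:
  shows R_add: "R (a + b) = R a + R b"
    and R_zero: "R 0 = 0"
    and R_scale: "R (sA c a) = sA c (R a)"
    and R_identity: "R a * R b = R (R a * b + a * R b) + sA \<kappa> (a * b)"
proof -
  interpret mrb_algebra \<kappa> "alg_of sA R" by (fact mrb_algebra_A)
  show add: "R (a + b) = R a + R b" and "R (sA c a) = sA c (R a)" for a b
    using rb_linear unfolding linear_on_def by (auto simp: alg_of_def)
  show "R 0 = 0"
    using add[of 0 0] by simp
  show "R a * R b = R (R a * b + a * R b) + sA \<kappa> (a * b)"
    using rb_identity[of a b] by (auto simp: alg_of_def)
qed

lemma mult_scale:
  shows "sA c a * b = sA c (a * b)" and "a * sA c b = sA c (a * b)"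
proof -
  interpret mrb_algebra \<kappa> "alg_of sA R" by (fact mrb_algebra_A)
  show "sA c a * b = sA c (a * b)" "a * sA c b = sA c (a * b)"
    using mul_linear_left[of b] mul_linear_right[of a]
    unfolding linear_on_def by (auto simp: alg_of_def)
qed

lemma linearI:
  assumes "\<And>a b. f (a + b) = f a + f b" "\<And>c a. f (sA c a) = sM c (f a)"
  shows "Vector_Spaces.linear sA sM f"
  using assms by (simp add: Vector_Spaces.linear_iff A.vector_space_axioms M.vector_space_axioms)

lemma linearD:
  assumes "Vector_Spaces.linear sA sM f"
  shows "f (a + b) = f a + f b" "f (sA c a) = sM c (f a)"
    "f 0 = 0" "f (- a) = - f a" "f (a - b) = f a - f b"
proof -
  interpret Vector_Spaces.linear sA sM f by fact
  show "f (a + b) = f a + f b" "f (sA c a) = sM c (f a)"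
    "f 0 = 0" "f (- a) = - f a" "f (a - b) = f a - f b"
    by (simp_all add: add scale zero neg diff)
qed

lemma action_simps [simp]:
  shows "l a (u + v) = l a u + l a v" "l a (sM c u) = sM c (l a u)"
    and "l a 0 = 0" "l a (- u) = - l a u" "l a (u - v) = l a u - l a v"
    and "r (u + v) b = r u b + r v b" "r (sM c u) b = sM c (r u b)"
    and "r 0 b = 0" "r (- u) b = - r u b" "r (u - v) b = r u b - r v b"
    and "S (u + v) = S u + S v" "S (sM c u) = sM c (S u)"
    and "S 0 = 0" "S (- u) = - S u" "S (u - v) = S u - S v"
proof -
  interpret l: Vector_Spaces.linear sM sM "l a" by (fact l_linear_M)
  interpret r: Vector_Spaces.linear sM sM "\<lambda>u. r u b" by (fact r_linear_M)
  interpret S: Vector_Spaces.linear sM sM S by (fact S_linear)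
  show "l a (u + v) = l a u + l a v" "l a (sM c u) = sM c (l a u)"
    "l a 0 = 0" "l a (- u) = - l a u" "l a (u - v) = l a u - l a v"
    "r (u + v) b = r u b + r v b" "r (sM c u) b = sM c (r u b)"
    "r 0 b = 0" "r (- u) b = - r u b" "r (u - v) b = r u b - r v b"
    "S (u + v) = S u + S v" "S (sM c u) = sM c (S u)"
    "S 0 = 0" "S (- u) = - S u" "S (u - v) = S u - S v"
    by (simp_all add: l.add l.scale l.zero l.neg l.diff r.add r.scale r.zero r.neg r.diff
        S.add S.scale S.zero S.neg S.diff)
qed

lemmas action_linear_simps [simp] = linearD[OF l_linear_A] linearD[OF r_linear_A]

section \<open>Cocycles and coboundaries in degree 2\<close>

text \<open>The four subsets of \<open>{0, 1}\<close> are listed by parity: the empty set gives the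
  term with \<open>R\<close> in both places, the full set the factor \<open>- \<kappa>\<close>, and
  each singleton one term under \<open>S\<close>.\<close>

lemma Psi_2:
  "Psi \<kappa> R sM S 2 \<chi> [a, b] =
    \<chi> [R a, R b] - sM \<kappa> (\<chi> [a, b]) - S (\<chi> [R a, b]) - S (\<chi> [a, R b])"
proof -
  have I: "I \<subseteq> {..<2} \<longleftrightarrow> I \<in> {{}, {0}, {1}, {0, 1::nat}}" for I
    unfolding Pow_iff[symmetric] by (simp add: numeral_2_eq_2 lessThan_Suc Pow_insert) blast
  have "{I. I \<subseteq> {..<2} \<and> even (card I)} = {{}, {0, 1::nat}}"
    "{I. I \<subseteq> {..<2} \<and> odd (card I)} = {{0}, {1::nat}}"
    unfolding I by auto
  then show ?thesis
    by (simp add: Psi_def twist_def)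
qed

text \<open>Terms are moved across so that both equations take the shape in which associativity and
  the modified Rota-Baxter identity appear in the \<open>M\<close>-component of a twisted
  structure.\<close>

lemma mrba_cocycles_2_iff:
  "(\<chi>, \<Phi>) \<in> mrba_cocycles \<kappa> sA R sM l r S 2 \<longleftrightarrow>
    \<chi> \<in> multilinear_maps sA sM 2 \<and> \<Phi> \<in> multilinear_maps sA sM 1 \<and>
    (\<forall>a b c. r (\<chi> [a, b]) c + \<chi> [a * b, c] = l a (\<chi> [b, c]) + \<chi> [a, b * c]) \<and>
    (\<forall>a b. l (R a) (\<Phi> [b]) + r (\<Phi> [a]) (R b) + \<chi> [R a, R b] =
      S (l a (\<Phi> [b]) + r (\<Phi> [a]) b + \<chi> [R a, b] + \<chi> [a, R b]) +
      \<Phi> [R a * b + a * R b] + sM \<kappa> (\<chi> [a, b]))"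
proof -
  have "hoch sM (*) l r 2 \<chi> = 0 \<longleftrightarrow>
    (\<forall>a b c. r (\<chi> [a, b]) c + \<chi> [a * b, c] = l a (\<chi> [b, c]) + \<chi> [a, b * c])"
  proof -
    have sum_1_2: "sum h {Suc 0..2} = h 1 + h 2" for h :: "nat \<Rightarrow> 'm"
      by (simp add: numeral_2_eq_2)
    have hoch_eq: "hoch sM (*) l r 2 \<chi> [a, b, c] =
      r (\<chi> [a, b]) c + \<chi> [a * b, c] - (l a (\<chi> [b, c]) + \<chi> [a, b * c])" for a b c
      by (simp add: hoch_def merge_def sum_1_2)
    \<comment> \<open>Cochains are functions on all lists; off the relevant length the differential
      is zero by convention, so only triples remain to be tested.\<close>
    moreover have "hoch sM (*) l r 2 \<chi> as = 0" if "length as \<noteq> 3" for as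
      using that by (simp add: hoch_def)
    ultimately have "hoch sM (*) l r 2 \<chi> = 0 \<longleftrightarrow> (\<forall>a b c. hoch sM (*) l r 2 \<chi> [a, b, c] = 0)"
      unfolding fun_eq_iff zero_fun_apply by (metis length_3_iff)
    then show ?thesis
      by (simp add: hoch_eq)
  qed
  moreover have "- hoch sM (mul_R R) (l_tilde R l S) (r_tilde R r S) 1 \<Phi> - Psi \<kappa> R sM S 2 \<chi> = 0 \<longleftrightarrow>
    (\<forall>a b. l (R a) (\<Phi> [b]) + r (\<Phi> [a]) (R b) + \<chi> [R a, R b] =
      S (l a (\<Phi> [b]) + r (\<Phi> [a]) b + \<chi> [R a, b] + \<chi> [a, R b]) +
      \<Phi> [R a * b + a * R b] + sM \<kappa> (\<chi> [a, b]))" (is "?f = 0 \<longleftrightarrow> _")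
  proof -
    have eq: "(- hoch sM (mul_R R) (l_tilde R l S) (r_tilde R r S) 1 \<Phi> - Psi \<kappa> R sM S 2 \<chi>) [a, b] =
      S (l a (\<Phi> [b]) + r (\<Phi> [a]) b + \<chi> [R a, b] + \<chi> [a, R b]) +
      \<Phi> [R a * b + a * R b] + sM \<kappa> (\<chi> [a, b]) -
      (l (R a) (\<Phi> [b]) + r (\<Phi> [a]) (R b) + \<chi> [R a, R b])" for a b
      by (simp add: hoch_def merge_def Psi_2 l_tilde_def r_tilde_def mul_R_def algebra_simps)
    moreover have "(- hoch sM (mul_R R) (l_tilde R l S) (r_tilde R r S) 1 \<Phi> - Psi \<kappa> R sM S 2 \<chi>) as = 0"
      if "length as \<noteq> 2" for as
      using that by (simp add: hoch_def Psi_def)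
    ultimately have "?f = 0 \<longleftrightarrow> (\<forall>a b. ?f [a, b] = 0)"
      unfolding fun_eq_iff zero_fun_apply by (metis length_2_iff)
    then show ?thesis
      by (subst (asm) eq) (simp only: right_minus_eq, metis)
  qed
  ultimately show ?thesis
    by (simp add: mrba_cocycles_def mrba_cochains_def mrba_diff_def zero_prod_def)
qed

text \<open>Both \<open>\<chi>\<close> and \<open>\<Phi>\<close> vanish on lists of the wrong
  length, as every coboundary does; hence equality with a coboundary can be tested on pairs and on
  single arguments.\<close>

lemma mrba_coboundaries_2_iff:
  assumes "\<chi> \<in> multilinear_maps sA sM 2" "\<Phi> \<in> multilinear_maps sA sM 1"
  shows "(\<chi>, \<Phi>) \<in> mrba_coboundaries \<kappa> sA R sM l r S 2 \<longleftrightarrow>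
    (\<exists>\<psi>. Vector_Spaces.linear sA sM \<psi> \<and>
      (\<forall>a b. \<chi> [a, b] = l a (\<psi> b) + r (\<psi> a) b - \<psi> (a * b)) \<and>
      (\<forall>a. \<Phi> [a] = S (\<psi> a) - \<psi> (R a)))"
proof -
  have hoch_1: "hoch sM (*) l r 1 f [a, b] = l a (f [b]) + r (f [a]) b - f [a * b]" for f a b
    by (simp add: hoch_def merge_def)
  have Psi_1: "Psi \<kappa> R sM S 1 f [a] = f [R a] - S (f [a])" for f a
  proof -
    have I: "I \<subseteq> {..<1} \<longleftrightarrow> I \<in> {{}, {0::nat}}" for I
      unfolding Pow_iff[symmetric] by (simp add: lessThan_Suc Pow_insert) blast
    have "{I. I \<subseteq> {..<1::nat} \<and> even (card I)} = {{}}"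
      "{I. I \<subseteq> {..<1} \<and> odd (card I)} = {{0::nat}}"
      unfolding I by auto
    then show ?thesis
      by (simp add: Psi_def twist_def)
  qed
  have hoch_0: "hoch sM (mul_R R) (l_tilde R l S) (r_tilde R r S) 0 g [a] =
    r_tilde R r S (g []) a - l_tilde R l S a (g [])" for g a
    by (simp add: hoch_def)
  have diff_iff: "mrba_diff \<kappa> R sM l r S 1 (f, g) = (\<chi>, \<Phi>) \<longleftrightarrow>
    (\<forall>a b. \<chi> [a, b] = l a (f [b]) + r (f [a]) b - f [a * b]) \<and>
    (\<forall>a. \<Phi> [a] = S (f [a]) - f [R a] + l_tilde R l S a (g []) - r_tilde R r S (g []) a)" for f g
  proof -
    have "hoch sM (*) l r 1 f = \<chi> \<longleftrightarrow> (\<forall>a b. \<chi> [a, b] = hoch sM (*) l r 1 f [a, b])"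
    proof
      assume *: "\<forall>a b. \<chi> [a, b] = hoch sM (*) l r 1 f [a, b]"
      show "hoch sM (*) l r 1 f = \<chi>"
      proof
        fix as
        show "hoch sM (*) l r 1 f as = \<chi> as"
        proof (cases "length as = 2")
          case True
          then show ?thesis using * by (auto simp: length_2_iff)
        next
          case False
          then show ?thesis
            using assms(1) by (simp add: multilinear_maps_2_iff hoch_def)
        qed
      qed
    qed simp
    moreover have "- hoch sM (mul_R R) (l_tilde R l S) (r_tilde R r S) 0 g - Psi \<kappa> R sM S 1 f = \<Phi> \<longleftrightarrow>
      (\<forall>a. \<Phi> [a] = (- hoch sM (mul_R R) (l_tilde R l S) (r_tilde R r S) 0 g - Psi \<kappa> R sM S 1 f) [a])"
      (is "?L = \<Phi> \<longleftrightarrow> _")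
    proof
      assume *: "\<forall>a. \<Phi> [a] = ?L [a]"
      show "?L = \<Phi>"
      proof
        fix as
        show "?L as = \<Phi> as"
        proof (cases "length as = 1")
          case True
          then show ?thesis using * by (auto simp: length_Suc_conv)
        next
          case False
          then show ?thesis
            using assms(2) by (simp add: multilinear_maps_1_iff hoch_def Psi_def)
        qed
      qed
    qed simp
    ultimately show ?thesis
      by (simp add: mrba_diff_def hoch_1[simplified] Psi_1[simplified] hoch_0 algebra_simps)
  qed
  show ?thesis
  proof
    assume "(\<chi>, \<Phi>) \<in> mrba_coboundaries \<kappa> sA R sM l r S 2"
    then obtain f g where f: "f \<in> multilinear_maps sA sM 1"
      and "mrba_diff \<kappa> R sM l r S 1 (f, g) = (\<chi>, \<Phi>)"
      by (auto simp: mrba_coboundaries_def mrba_cochains_def)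
    note eqs = this(2)[unfolded diff_iff]
    \<comment> \<open>The differential of the degree 0 cochain \<open>g\<close> is \<open>(\<delta> g, - g)\<close>; adding it to \<open>(f, g)\<close>
      removes the second component without changing the coboundary.\<close>
    define \<psi> where "\<psi> a = f [a] - l a (g []) + r (g []) a" for a
    have "Vector_Spaces.linear sA sM (\<lambda>a. f [a])"
      using f by (simp only: multilinear_maps_1_iff One_nat_def)
    note lin = linearD[OF this]
    have "Vector_Spaces.linear sA sM \<psi>"
      by (intro linearI)
        (simp_all add: \<psi>_def lin M.scale_right_distrib M.scale_right_diff_distrib)
    \<comment> \<open>In the equation for \<open>\<chi>\<close> the terms in \<open>g []\<close>
      cancel by the bimodule axioms, which is the identity that the Hochschild differential squares
      to zero. In the equation for \<open>\<Phi>\<close> they are exactly the \<open>l_tilde\<close>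
      and \<open>r_tilde\<close> terms of \<open>diff_iff\<close>.\<close>
    with eqs show "\<exists>\<psi>. Vector_Spaces.linear sA sM \<psi> \<and>
      (\<forall>a b. \<chi> [a, b] = l a (\<psi> b) + r (\<psi> a) b - \<psi> (a * b)) \<and>
      (\<forall>a. \<Phi> [a] = S (\<psi> a) - \<psi> (R a))"
      by (intro exI[of _ \<psi>])
        (simp add: \<psi>_def l_tilde_def r_tilde_def l_mul r_mul l_r algebra_simps)
  next
    assume "\<exists>\<psi>. Vector_Spaces.linear sA sM \<psi> \<and>
      (\<forall>a b. \<chi> [a, b] = l a (\<psi> b) + r (\<psi> a) b - \<psi> (a * b)) \<and>
      (\<forall>a. \<Phi> [a] = S (\<psi> a) - \<psi> (R a))"
    then obtain \<psi> where \<psi>: "Vector_Spaces.linear sA sM \<psi>"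
      "\<And>a b. \<chi> [a, b] = l a (\<psi> b) + r (\<psi> a) b - \<psi> (a * b)"
      "\<And>a. \<Phi> [a] = S (\<psi> a) - \<psi> (R a)"
      by blast
    define f where "f as = (if length as = 1 then \<psi> (hd as) else 0)" for as
    have "f \<in> multilinear_maps sA sM 1"
      using \<psi>(1) by (simp add: multilinear_maps_1_iff f_def)
    moreover have "0 \<in> multilinear_maps sA sM 0"
      by (simp add: multilinear_maps_def)
    moreover have "mrba_diff \<kappa> R sM l r S 1 (f, 0) = (\<chi>, \<Phi>)"
      unfolding diff_iff using \<psi> by (simp add: f_def l_tilde_def r_tilde_def)
    ultimately show "(\<chi>, \<Phi>) \<in> mrba_coboundaries \<kappa> sA R sM l r S 2"
      by (force simp: mrba_coboundaries_def mrba_cochains_def)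
  qed
qed


section \<open>The extension attached to a cocycle\<close>

abbreviation twisted :: "('a list \<Rightarrow> 'm) \<times> ('a list \<Rightarrow> 'm) \<Rightarrow> ('k, 'a, 'm, 'e) extension_data"
  where "twisted \<equiv> twisted_extension \<iota> sA R sM l r S"

abbreviation twisted_algebra :: "('a list \<Rightarrow> 'm) \<times> ('a list \<Rightarrow> 'm) \<Rightarrow> ('k, 'e) mrb_struct"
  where "twisted_algebra c \<equiv> fst (twisted c)"

lemma emb_simps [simp]: "inv \<iota> (\<iota> x) = x" "\<iota> x = \<iota> y \<longleftrightarrow> x = y"
  using inj_emb by (simp_all add: inj_eq)

lemma twisted_simps [simp]:
  shows "carrier (twisted_algebra c) = range \<iota>"
    and "vzero (twisted_algebra c) = \<iota> (0, 0)"
    and "\<iota> (a, u) \<oplus>\<^bsub>twisted_algebra c\<^esub> \<iota> (b, v) = \<iota> (a + b, u + v)"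
    and "k \<odot>\<^bsub>twisted_algebra c\<^esub> \<iota> (a, u) = \<iota> (sA k a, sM k u)"
    and "\<iota> (a, u) \<otimes>\<^bsub>twisted_algebra c\<^esub> \<iota> (b, v) = \<iota> (a * b, l a v + r u b + fst c [a, b])"
    and "rb (twisted_algebra c) (\<iota> (a, u)) = \<iota> (R a, S u + snd c [a])"
  by (simp_all add: twisted_extension_def split_beta)

text \<open>Exposes the triple that the definitions on extension data match against, while the
  algebra stays in the form known to \<open>twisted_simps\<close>. It is applied by
  \<open>subst\<close> because the left side recurs inside the right side.\<close>

lemma twisted_eq: "twisted c = (twisted_algebra c, \<lambda>u. \<iota> (0, u), \<lambda>x. fst (inv \<iota> x))"
  by (simp add: twisted_extension_def split_beta)

text \<open>The cochain enters only the product and the operator, so \<open>c\<close> may be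
  arbitrary here.\<close>

lemma carrier_vector_space_twisted: "carrier_vector_space (twisted_algebra c)"
proof
  fix x assume "x \<in> carrier (twisted_algebra c)"
  then obtain a u where x: "x = \<iota> (a, u)" by auto
  then have "x \<oplus>\<^bsub>twisted_algebra c\<^esub> \<iota> (- a, - u) = \<zero>\<^bsub>twisted_algebra c\<^esub>"
    by simp
  then show "\<exists>y\<in>carrier (twisted_algebra c). x \<oplus>\<^bsub>twisted_algebra c\<^esub> y = \<zero>\<^bsub>twisted_algebra c\<^esub>"
    by (intro bexI[of _ "\<iota> (- a, - u)"]) simp_all
qed (auto simp: algebra_simps A.scale_right_distrib A.scale_left_distrib
      M.scale_right_distrib M.scale_left_distrib)

lemma twisted_bilinear:
  assumes "fst c \<in> multilinear_maps sA sM 2" "snd c \<in> multilinear_maps sA sM 1"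
  shows "fst c [a + a', b] = fst c [a, b] + fst c [a', b]" "fst c [sA k a, b] = sM k (fst c [a, b])"
    and "fst c [a, b + b'] = fst c [a, b] + fst c [a, b']" "fst c [a, sA k b] = sM k (fst c [a, b])"
    and "fst c [0, b] = 0" "fst c [a, 0] = 0"
    and "snd c [a + a'] = snd c [a] + snd c [a']" "snd c [sA k a] = sM k (snd c [a])" "snd c [0] = 0"
  using assms linearD(1-3)[of "\<lambda>a. fst c [a, b]" for b] linearD(1-3)[of "\<lambda>b. fst c [a, b]" for a]
    linearD(1-3)[of "\<lambda>a. snd c [a]"]
  by (simp_all add: multilinear_maps_1_iff multilinear_maps_2_iff)

text \<open>In each identity the \<open>A\<close>-component is the same identity in
  \<open>A\<close>. In the \<open>M\<close>-component the terms linear in the module entries match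
  by the bimodule axioms, and the rest is a cocycle equation.\<close>

lemma mrb_algebra_twisted:
  assumes "c \<in> mrba_cocycles \<kappa> sA R sM l r S 2"
  shows "mrb_algebra \<kappa> (twisted_algebra c)"
proof -
  have c: "fst c \<in> multilinear_maps sA sM 2" "snd c \<in> multilinear_maps sA sM 1"
    "\<And>a b d. r (fst c [a, b]) d + fst c [a * b, d] = l a (fst c [b, d]) + fst c [a, b * d]"
    "\<And>a b. l (R a) (snd c [b]) + r (snd c [a]) (R b) + fst c [R a, R b] =
      S (l a (snd c [b]) + r (snd c [a]) b + fst c [R a, b] + fst c [a, R b]) +
      snd c [R a * b + a * R b] + sM \<kappa> (fst c [a, b])"
    using assms mrba_cocycles_2_iff[of "fst c" "snd c"] by simp_all
  note bilin = twisted_bilinear[OF c(1,2)]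
  interpret carrier_vector_space "twisted_algebra c"
    by (fact carrier_vector_space_twisted)
  show ?thesis
  proof
    fix x y z assume "x \<in> carrier (twisted_algebra c)" "y \<in> carrier (twisted_algebra c)"
      "z \<in> carrier (twisted_algebra c)"
    then obtain a u b v d w where xyz: "x = \<iota> (a, u)" "y = \<iota> (b, v)" "z = \<iota> (d, w)"
      by auto
    show "(x \<otimes>\<^bsub>twisted_algebra c\<^esub> y) \<otimes>\<^bsub>twisted_algebra c\<^esub> z =
        x \<otimes>\<^bsub>twisted_algebra c\<^esub> (y \<otimes>\<^bsub>twisted_algebra c\<^esub> z)"
      using c(3)[of a b d] by (simp add: xyz l_mul r_mul l_r mult.assoc algebra_simps)
  next
    fix x y assume "x \<in> carrier (twisted_algebra c)" "y \<in> carrier (twisted_algebra c)"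
    then obtain a u b v where xy: "x = \<iota> (a, u)" "y = \<iota> (b, v)"
      by auto
    show "rb (twisted_algebra c) x \<otimes>\<^bsub>twisted_algebra c\<^esub> rb (twisted_algebra c) y =
      rb (twisted_algebra c) (rb (twisted_algebra c) x \<otimes>\<^bsub>twisted_algebra c\<^esub> y
        \<oplus>\<^bsub>twisted_algebra c\<^esub> x \<otimes>\<^bsub>twisted_algebra c\<^esub> rb (twisted_algebra c) y)
      \<oplus>\<^bsub>twisted_algebra c\<^esub> \<kappa> \<odot>\<^bsub>twisted_algebra c\<^esub> (x \<otimes>\<^bsub>twisted_algebra c\<^esub> y)"
      using c(4)[of a b]
      by (simp add: xy R_identity l_identity r_identity M.scale_right_distrib algebra_simps)
  qed (auto simp: linear_on_def bilin R_simps mult_scale M.scale_right_distrib algebra_simps)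
qed

text \<open>Multilinearity of the cochain is forced by bilinearity of the product and linearity of the operator.\<close>

lemma mrba_cocyclesI:
  assumes "mrb_algebra \<kappa> (twisted_algebra (\<chi>, \<Phi>))"
    and "\<And>as. length as \<noteq> 2 \<Longrightarrow> \<chi> as = 0" "\<And>as. length as \<noteq> 1 \<Longrightarrow> \<Phi> as = 0"
  shows "(\<chi>, \<Phi>) \<in> mrba_cocycles \<kappa> sA R sM l r S 2"
proof -
  interpret E: mrb_algebra \<kappa> "twisted_algebra (\<chi>, \<Phi>)" by fact
  have "Vector_Spaces.linear sA sM (\<lambda>a. \<chi> [a, b])" for b
    using E.mul_linear_left[of "\<iota> (b, 0)"]
    by (intro linearI) (simp_all add: linear_on_def split_paired_All M.scale_right_distrib)
  moreover have "Vector_Spaces.linear sA sM (\<lambda>b. \<chi> [a, b])" for a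
    using E.mul_linear_right[of "\<iota> (a, 0)"]
    by (intro linearI) (simp_all add: linear_on_def split_paired_All M.scale_right_distrib)
  moreover have \<Phi>: "Vector_Spaces.linear sA sM (\<lambda>a. \<Phi> [a])"
    using E.rb_linear
    by (intro linearI) (simp_all add: linear_on_def split_paired_All M.scale_right_distrib)
  \<comment> \<open>On elements with zero \<open>M\<close>-component the products carry no module
    terms besides those coming from the cochain, so the algebra identities reduce to the cocycle
    equations.\<close>
  moreover have "r (\<chi> [a, b]) d + \<chi> [a * b, d] = l a (\<chi> [b, d]) + \<chi> [a, b * d]" for a b d
    using E.mul_assoc[of "\<iota> (a, 0)" "\<iota> (b, 0)" "\<iota> (d, 0)"] by simp
  moreover have "l (R a) (\<Phi> [b]) + r (\<Phi> [a]) (R b) + \<chi> [R a, R b] =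
      S (l a (\<Phi> [b]) + r (\<Phi> [a]) b + \<chi> [R a, b] + \<chi> [a, R b]) +
      \<Phi> [R a * b + a * R b] + sM \<kappa> (\<chi> [a, b])" for a b
    using E.rb_identity[of "\<iota> (a, 0)" "\<iota> (b, 0)"] by (simp add: algebra_simps)
  ultimately show ?thesis
    using assms(2,3) by (simp add: mrba_cocycles_2_iff multilinear_maps_1_iff multilinear_maps_2_iff)
qed

lemma twisted_in_extensions:
  assumes "c \<in> mrba_cocycles \<kappa> sA R sM l r S 2"
  shows "twisted c \<in> extensions \<kappa> sA R sM l r S"
proof -
  have "fst c \<in> multilinear_maps sA sM 2" "snd c \<in> multilinear_maps sA sM 1"
    using assms mrba_cocycles_2_iff[of "fst c" "snd c"] by simp_all
  note bilin = twisted_bilinear[OF this]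
  have "abelian_extension \<kappa> sA R sM S (twisted c)"
    using mrb_algebra_twisted[OF assms] R_simps
    by (subst twisted_eq)
      (auto simp: abelian_extension_def mrb_hom_def linear_on_def null_alg_of_def alg_of_def bilin
        linearD image_iff intro!: injI)
  \<comment> \<open>For the section \<open>a \<mapsto> \<iota> (a, 0)\<close> the products with
    \<open>\<iota> (0, u)\<close> involve \<open>\<chi>\<close> only with a zero argument, so they
    return the given actions.\<close>
  moreover have "induces_bimodule sA R l r (twisted c)"
    by (subst twisted_eq)
      (auto simp: induces_bimodule_def linear_section_def linear_on_def alg_of_def bilin
        intro!: exI[of _ "\<lambda>a. \<iota> (a, 0)"])
  ultimately show ?thesis
    by (simp add: extensions_def)
qed

lemma extension_iso_twisted_iff:
  assumes c: "c \<in> mrba_cocycles \<kappa> sA R sM l r S 2" and c': "c' \<in> mrba_cocycles \<kappa> sA R sM l r S 2"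
  shows "extension_iso (twisted c) (twisted c') \<longleftrightarrow> c - c' \<in> mrba_coboundaries \<kappa> sA R sM l r S 2"
proof -
  have ml: "fst c \<in> multilinear_maps sA sM 2" "snd c \<in> multilinear_maps sA sM 1"
    and ml': "fst c' \<in> multilinear_maps sA sM 2" "snd c' \<in> multilinear_maps sA sM 1"
    using c c' mrba_cocycles_2_iff[of "fst c" "snd c"] mrba_cocycles_2_iff[of "fst c'" "snd c'"]
    by simp_all
  note bilin = twisted_bilinear[OF ml] twisted_bilinear[OF ml']
  have "fst c - fst c' \<in> multilinear_maps sA sM 2" "snd c - snd c' \<in> multilinear_maps sA sM 1"
    using ml ml'
    by (auto simp: multilinear_maps_1_iff multilinear_maps_2_iff bilin
        M.scale_right_diff_distrib intro!: linearI)
  note cob_iff = mrba_coboundaries_2_iff[OF this]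
  have c_diff: "c - c' = (fst c - fst c', snd c - snd c')"
    by (simp add: minus_prod_def)
  show ?thesis
    unfolding c_diff cob_iff
  proof
    assume "extension_iso (twisted c) (twisted c')"
    then obtain \<phi> where iso: "mrb_iso (twisted_algebra c) (twisted_algebra c') \<phi>"
      and \<phi>_incl: "\<And>u. \<phi> (\<iota> (0, u)) = \<iota> (0, u)"
      and \<phi>_proj: "\<And>x. fst (inv \<iota> (\<phi> (\<iota> x))) = fst x"
      by (subst (asm) (1 2) twisted_eq) (auto simp: extension_iso_def)
    note \<phi> = mrb_isoD[OF iso]
    \<comment> \<open>Since \<open>\<phi>\<close> preserves the projection to \<open>A\<close>, it
      can move the standard section only in the \<open>M\<close>-direction; \<open>\<psi>\<close>
      records this displacement.\<close>
    define \<psi> where "\<psi> a = snd (inv \<iota> (\<phi> (\<iota> (a, 0))))" for a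
    have \<phi>_section: "\<phi> (\<iota> (a, 0)) = \<iota> (a, \<psi> a)" for a
      using \<phi>(1)[of "\<iota> (a, 0)"] \<phi>_proj[of "(a, 0)"] by (auto simp: \<psi>_def)
    have \<phi>_eq: "\<phi> (\<iota> (a, u)) = \<iota> (a, \<psi> a + u)" for a u
      using \<phi>(2)[of "\<iota> (a, 0)" "\<iota> (0, u)"] by (simp add: \<phi>_section \<phi>_incl)
    have "Vector_Spaces.linear sA sM \<psi>"
    proof (rule linearI)
      show "\<psi> (a + b) = \<psi> a + \<psi> b" for a b
        using \<phi>(2)[of "\<iota> (a, 0)" "\<iota> (b, 0)"] by (simp add: \<phi>_eq)
      show "\<psi> (sA k a) = sM k (\<psi> a)" for k a
        using \<phi>(3)[of "\<iota> (a, 0)" k] by (simp add: \<phi>_eq)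
    qed
    \<comment> \<open>Comparing \<open>M\<close>-components of \<open>\<phi>\<close> applied to a
      product of section elements gives the first equation; applying it to the operator gives the
      second.\<close>
    moreover have "(fst c - fst c') [a, b] = l a (\<psi> b) + r (\<psi> a) b - \<psi> (a * b)" for a b
      using \<phi>(4)[of "\<iota> (a, 0)" "\<iota> (b, 0)"] by (simp add: \<phi>_eq algebra_simps)
    moreover have "(snd c - snd c') [a] = S (\<psi> a) - \<psi> (R a)" for a
      using \<phi>(5)[of "\<iota> (a, 0)"] by (simp add: \<phi>_eq algebra_simps)
    ultimately show "\<exists>\<psi>. Vector_Spaces.linear sA sM \<psi> \<and>
      (\<forall>a b. (fst c - fst c') [a, b] = l a (\<psi> b) + r (\<psi> a) b - \<psi> (a * b)) \<and>
      (\<forall>a. (snd c - snd c') [a] = S (\<psi> a) - \<psi> (R a))"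
      by blast
  next
    assume "\<exists>\<psi>. Vector_Spaces.linear sA sM \<psi> \<and>
      (\<forall>a b. (fst c - fst c') [a, b] = l a (\<psi> b) + r (\<psi> a) b - \<psi> (a * b)) \<and>
      (\<forall>a. (snd c - snd c') [a] = S (\<psi> a) - \<psi> (R a))"
    then obtain \<psi> where lin: "Vector_Spaces.linear sA sM \<psi>"
      and "\<And>a b. (fst c - fst c') [a, b] = l a (\<psi> b) + r (\<psi> a) b - \<psi> (a * b)"
      and "\<And>a. (snd c - snd c') [a] = S (\<psi> a) - \<psi> (R a)"
      by blast
    then have fst_c: "fst c [a, b] = fst c' [a, b] + l a (\<psi> b) + r (\<psi> a) b - \<psi> (a * b)"
      and snd_c: "snd c [a] = snd c' [a] + S (\<psi> a) - \<psi> (R a)" for a b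
      by (simp_all add: algebra_simps eq_diff_eq diff_eq_eq)
    define \<phi> where "\<phi> x = (case inv \<iota> x of (a, u) \<Rightarrow> \<iota> (a, u + \<psi> a))" for x
    have \<phi>_simp [simp]: "\<phi> (\<iota> (a, u)) = \<iota> (a, u + \<psi> a)" for a u
      by (simp add: \<phi>_def)
    have "bij_betw \<phi> (range \<iota>) (range \<iota>)"
      by (rule bij_betw_byWitness[where f' = "\<lambda>x. case inv \<iota> x of (a, u) \<Rightarrow> \<iota> (a, u - \<psi> a)"]) auto
    then have "mrb_iso (twisted_algebra c) (twisted_algebra c') \<phi>"
      by (auto simp: mrb_iso_def mrb_hom_def linear_on_def linearD[OF lin] fst_c snd_c
          M.scale_right_distrib algebra_simps)
    then show "extension_iso (twisted c) (twisted c')"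
      by (subst (1 2) twisted_eq) (auto simp: extension_iso_def linearD[OF lin] intro!: exI[of _ \<phi>])
  qed
qed

section \<open>The cocycle of an extension\<close>

text \<open>The cocycle equations are not computed inside \<open>E\<close>. The map
  \<open>\<phi>\<close> identifies the twisted structure of the defect cochain with
  \<open>E\<close>, so that structure is an algebra by pullback, and \<open>mrba_cocyclesI\<close>
  reads off the equations.\<close>

lemma exists_extension_iso_twisted:
  assumes "X \<in> extensions \<kappa> sA R sM l r S"
  shows "\<exists>c\<in>mrba_cocycles \<kappa> sA R sM l r S 2. extension_iso (twisted c) X"
proof -
  obtain E i p where X: "X = (E, i, p)"
    by (cases X) auto
  interpret E: mrb_algebra \<kappa> E
    using assms by (simp add: X extensions_def abelian_extension_def)
  have i: "i u \<in> carrier E" "i (u + v) = i u \<oplus>\<^bsub>E\<^esub> i v" "i (sM k u) = k \<odot>\<^bsub>E\<^esub> i u"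
    "i u \<otimes>\<^bsub>E\<^esub> i v = i 0" "rb E (i u) = i (S u)" "i u = i v \<longleftrightarrow> u = v" for u v k
    using assms by (simp_all add: X extensions_def abelian_extension_def mrb_hom_def linear_on_def
        null_alg_of_def inj_eq)
  have p: "\<And>x y. \<lbrakk>x \<in> carrier E; y \<in> carrier E\<rbrakk> \<Longrightarrow> p (x \<oplus>\<^bsub>E\<^esub> y) = p x + p y"
    "\<And>k x. x \<in> carrier E \<Longrightarrow> p (k \<odot>\<^bsub>E\<^esub> x) = sA k (p x)"
    "\<And>x y. \<lbrakk>x \<in> carrier E; y \<in> carrier E\<rbrakk> \<Longrightarrow> p (x \<otimes>\<^bsub>E\<^esub> y) = p x * p y"
    "\<And>x. x \<in> carrier E \<Longrightarrow> p (rb E x) = R (p x)"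
    using assms by (simp_all add: X extensions_def abelian_extension_def mrb_hom_def linear_on_def
        alg_of_def)
  have exact: "range i = {x \<in> carrier E. p x = 0}"
    using assms by (simp add: X extensions_def abelian_extension_def)
  then have p_i: "p (i u) = 0" for u
    by blast
  obtain s where s_section: "linear_section sA R (E, i, p) s"
    and actions: "\<And>a u. i (l a u) = s a \<otimes>\<^bsub>E\<^esub> i u \<and> i (r u a) = i u \<otimes>\<^bsub>E\<^esub> s a"
    using assms by (auto simp: X extensions_def induces_bimodule_def)
  have s: "s a \<in> carrier E" "s (a + b) = s a \<oplus>\<^bsub>E\<^esub> s b" "s (sA k a) = k \<odot>\<^bsub>E\<^esub> s a"
    "p (s a) = a" "s a \<otimes>\<^bsub>E\<^esub> i u = i (l a u)" "i u \<otimes>\<^bsub>E\<^esub> s a = i (r u a)" for a b k u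
    using s_section actions by (simp_all add: linear_section_def linear_on_def alg_of_def)
  \<comment> \<open>The difference of \<open>x\<close> and \<open>s (p x)\<close> lies in the kernel
    of \<open>p\<close>, hence in the range of \<open>i\<close>. Subtraction is expressed through
    the scalar \<open>- 1\<close>, as the structure has no minus.\<close>
  have s_i: "\<exists>u. x = s (p x) \<oplus>\<^bsub>E\<^esub> i u" if x: "x \<in> carrier E" for x
  proof -
    have neg: "(- 1) \<odot>\<^bsub>E\<^esub> s (p x) \<in> carrier E"
      by (simp add: E.smul_closed s)
    then have "x \<oplus>\<^bsub>E\<^esub> (- 1) \<odot>\<^bsub>E\<^esub> s (p x) \<in> range i"
      using x by (simp add: exact p s E.add_closed)
    then obtain u where u: "i u = x \<oplus>\<^bsub>E\<^esub> (- 1) \<odot>\<^bsub>E\<^esub> s (p x)"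
      by force
    have "s (p x) \<oplus>\<^bsub>E\<^esub> (- 1) \<odot>\<^bsub>E\<^esub> s (p x) = \<zero>\<^bsub>E\<^esub>"
      using E.smul_add_left[of "s (p x)" 1 "- 1"] by (simp add: s E.smul_one E.smul_zero)
    then have "s (p x) \<oplus>\<^bsub>E\<^esub> i u = x"
      using E.add_left_commute[of "s (p x)" x] x neg by (simp add: u s E.add_zero)
    then show ?thesis
      by metis
  qed
  \<comment> \<open>Both sides have the same image under \<open>p\<close>, so \<open>s_i\<close>
    yields the defects of \<open>s\<close> for the product and the operator.\<close>
  have "\<exists>u. s a \<otimes>\<^bsub>E\<^esub> s b = s (a * b) \<oplus>\<^bsub>E\<^esub> i u" for a b
    using s_i[of "s a \<otimes>\<^bsub>E\<^esub> s b"] by (simp add: E.closed s p)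
  then obtain f where f: "\<And>a b. s a \<otimes>\<^bsub>E\<^esub> s b = s (a * b) \<oplus>\<^bsub>E\<^esub> i (f a b)"
    by metis
  have "\<exists>u. rb E (s a) = s (R a) \<oplus>\<^bsub>E\<^esub> i u" for a
    using s_i[of "rb E (s a)"] by (simp add: E.closed s p)
  then obtain g where g: "\<And>a. rb E (s a) = s (R a) \<oplus>\<^bsub>E\<^esub> i (g a)"
    by metis
  \<comment> \<open>The value zero off the right length is what membership in
    \<open>multilinear_maps\<close> asks for.\<close>
  define \<chi> where "\<chi> as = (if length as = 2 then f (as ! 0) (as ! 1) else 0)" for as
  define \<Phi> where "\<Phi> as = (if length as = 1 then g (hd as) else 0)" for as
  have \<chi>\<Phi>: "\<chi> [a, b] = f a b" "\<Phi> [a] = g a" for a b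
    by (simp_all add: \<chi>_def \<Phi>_def)
  define \<phi> where "\<phi> x = (case inv \<iota> x of (a, u) \<Rightarrow> s a \<oplus>\<^bsub>E\<^esub> i u)" for x
  have \<phi>: "\<phi> (\<iota> (a, u)) = s a \<oplus>\<^bsub>E\<^esub> i u" for a u
    by (simp add: \<phi>_def)
  note E_closed = E.add_closed E.smul_closed E.closed i(1) s(1)
  have add: "(s a \<oplus>\<^bsub>E\<^esub> i u) \<oplus>\<^bsub>E\<^esub> i v = s a \<oplus>\<^bsub>E\<^esub> i (u + v)" for a u v
    by (simp add: E.add_assoc i s)
  have lin: "linear_on E E (\<lambda>y. x \<otimes>\<^bsub>E\<^esub> y)" "linear_on E E (\<lambda>y. y \<otimes>\<^bsub>E\<^esub> x)" if "x \<in> carrier E" for x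
    using that by (simp_all add: E.mul_linear_left E.mul_linear_right)
  have \<phi>_hom: "mrb_hom (twisted_algebra (\<chi>, \<Phi>)) E \<phi>"
  proof -
    have "\<phi> (\<iota> (a, u) \<oplus>\<^bsub>twisted_algebra (\<chi>, \<Phi>)\<^esub> \<iota> (b, v)) = \<phi> (\<iota> (a, u)) \<oplus>\<^bsub>E\<^esub> \<phi> (\<iota> (b, v))"
      for a u b v
    proof -
      have "\<phi> (\<iota> (a, u)) \<oplus>\<^bsub>E\<^esub> \<phi> (\<iota> (b, v)) = s a \<oplus>\<^bsub>E\<^esub> (s b \<oplus>\<^bsub>E\<^esub> (i u \<oplus>\<^bsub>E\<^esub> i v))"
        using E.add_left_commute[of "i u" "s b" "i v"] by (simp add: \<phi> E.add_assoc E_closed)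
      then show ?thesis
        by (simp add: \<phi> s(2) i(2) E.add_assoc E_closed)
    qed
    moreover have "\<phi> (k \<odot>\<^bsub>twisted_algebra (\<chi>, \<Phi>)\<^esub> \<iota> (a, u)) = k \<odot>\<^bsub>E\<^esub> \<phi> (\<iota> (a, u))" for k a u
      by (simp add: \<phi> s(3) i(3) E.smul_add_right E_closed)
    moreover have "\<phi> (\<iota> (a, u) \<otimes>\<^bsub>twisted_algebra (\<chi>, \<Phi>)\<^esub> \<iota> (b, v)) = \<phi> (\<iota> (a, u)) \<otimes>\<^bsub>E\<^esub> \<phi> (\<iota> (b, v))"
      for a u b v
    proof -
      have "\<phi> (\<iota> (a, u)) \<otimes>\<^bsub>E\<^esub> \<phi> (\<iota> (b, v)) =
        (s a \<otimes>\<^bsub>E\<^esub> s b \<oplus>\<^bsub>E\<^esub> i u \<otimes>\<^bsub>E\<^esub> s b) \<oplus>\<^bsub>E\<^esub> (s a \<otimes>\<^bsub>E\<^esub> i v \<oplus>\<^bsub>E\<^esub> i u \<otimes>\<^bsub>E\<^esub> i v)"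
        using lin[of "s a \<oplus>\<^bsub>E\<^esub> i u"] lin[of "s b"] lin[of "i v"]
        by (simp add: \<phi> linear_on_def E_closed)
      \<comment> \<open>The summand \<open>0\<close> is the product of \<open>i u\<close> and
        \<open>i v\<close>, which vanishes since \<open>M\<close> carries the zero
        multiplication.\<close>
      also have "\<dots> = s (a * b) \<oplus>\<^bsub>E\<^esub> i (f a b + r u b + (l a v + 0))"
        by (simp only: f s(5,6) i(4) i(2)[symmetric] add)
      finally show ?thesis
        by (simp add: \<phi> \<chi>\<Phi> add_ac)
    qed
    moreover have "rb E (\<phi> (\<iota> (a, u))) = \<phi> (rb (twisted_algebra (\<chi>, \<Phi>)) (\<iota> (a, u)))" for a u
    proof -
      have "rb E (\<phi> (\<iota> (a, u))) = rb E (s a) \<oplus>\<^bsub>E\<^esub> rb E (i u)"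
        using E.rb_linear by (simp add: \<phi> linear_on_def E_closed)
      also have "\<dots> = s (R a) \<oplus>\<^bsub>E\<^esub> i (g a + S u)"
        by (simp only: g i(5) add)
      finally show ?thesis
        by (simp add: \<phi> \<chi>\<Phi> add_ac)
    qed
    ultimately show ?thesis
      \<comment> \<open>The evaluation rules are switched off so that the goals keep the form of the
        facts just proved.\<close>
      by (auto simp: mrb_hom_def linear_on_def \<phi> E_closed simp del: twisted_simps(3-6))
  qed
  have "inj_on \<phi> (range \<iota>)"
  proof (rule inj_onI)
    fix x y assume "x \<in> range \<iota>" "y \<in> range \<iota>" and eq: "\<phi> x = \<phi> y"
    then obtain a u b v where xy: "x = \<iota> (a, u)" "y = \<iota> (b, v)"
      by auto
    have "a = b"
      using arg_cong[OF eq, of p] by (simp add: xy \<phi> p s p_i E_closed)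
    moreover have "u = v"
      using eq E.add_left_cancel[of "s a" "i u" "i v"] by (simp add: xy \<phi> \<open>a = b\<close> E_closed i(6))
    ultimately show "x = y"
      by (simp add: xy)
  qed
  moreover have "\<phi> ` range \<iota> = carrier E"
  proof
    show "carrier E \<subseteq> \<phi> ` range \<iota>"
    proof
      fix x assume "x \<in> carrier E"
      then obtain u where "x = \<phi> (\<iota> (p x, u))"
        using s_i by (metis \<phi>)
      then show "x \<in> \<phi> ` range \<iota>"
        by blast
    qed
  qed (auto simp: \<phi> E_closed)
  ultimately have bij: "bij_betw \<phi> (range \<iota>) (carrier E)"
    by (simp add: bij_betw_def)
  have "mrb_algebra \<kappa> (twisted_algebra (\<chi>, \<Phi>))"
    using carrier_vector_space_twisted E.mrb_algebra_axioms \<phi>_hom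
    by (rule mrb_algebra_pullback) (use bij in \<open>auto simp: bij_betw_def\<close>)
  then have "(\<chi>, \<Phi>) \<in> mrba_cocycles \<kappa> sA R sM l r S 2"
    by (rule mrba_cocyclesI) (simp_all add: \<chi>_def \<Phi>_def)
  moreover have "extension_iso (twisted (\<chi>, \<Phi>)) X"
  proof -
    \<comment> \<open>\<open>linear_on\<close> does not mention zero, so this is obtained by scaling
      with \<open>0\<close>.\<close>
    have "s 0 = \<zero>\<^bsub>E\<^esub>"
      using s(3)[of 0 0] by (simp add: E.smul_zero s)
    then have "\<phi> (\<iota> (0, u)) = i u" for u
      using E.add_commute[of "s 0" "i u"] by (simp add: \<phi> E.add_zero E.zero_closed i)
    then show ?thesis
      using \<phi>_hom bij
      by (subst twisted_eq)
        (auto simp: X extension_iso_def mrb_iso_def \<phi> p p_i s E_closed intro!: exI[of _ \<phi>])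
  qed
  ultimately show ?thesis
    by blast
qed

end

section \<open>The correspondence between extension classes and cohomology classes\<close>

theorem theorem5p2:
  fixes \<kappa> :: "'k::field_char_0"
    and sA :: "'k \<Rightarrow> 'a::ring \<Rightarrow> 'a" and R :: "'a \<Rightarrow> 'a"
    and sM :: "'k \<Rightarrow> 'm::ab_group_add \<Rightarrow> 'm"
    and l :: "'a \<Rightarrow> 'm \<Rightarrow> 'm" and r :: "'m \<Rightarrow> 'a \<Rightarrow> 'm" and S :: "'m \<Rightarrow> 'm"
  assumes "mrb_algebra \<kappa> (alg_of sA R)"
    and "mrb_bimodule \<kappa> sA R sM l r S"
    and "\<exists>\<iota> :: 'a \<times> 'm \<Rightarrow> 'e. inj \<iota>"
  shows "\<exists>F. bij_betw F (Ext \<kappa> sA R sM l r S :: ('k, 'a, 'm, 'e) extension_data set set)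
                        (mrba_cohomology \<kappa> sA R sM l r S 2)"
proof -
  obtain \<iota> :: "'a \<times> 'm \<Rightarrow> 'e" where "inj \<iota>"
    using assms(3) by blast
  then interpret mrb_algebra_with_bimodule \<kappa> sA R sM l r S \<iota>
    using assms(1,2) by (simp add: mrb_algebra_with_bimodule_def mrb_algebra_with_bimodule_axioms_def)
  let ?Z = "mrba_cocycles \<kappa> sA R sM l r S 2"
  let ?X = "extensions \<kappa> sA R sM l r S :: ('k, 'a, 'm, 'e) extension_data set"
  have sym: "extension_iso Y X" if "X \<in> ?X" "extension_iso X Y" for X Y :: "('k, 'a, 'm, 'e) extension_data"
    using extension_iso_sym[of \<kappa> sA R sM S X Y] that by (auto simp: extensions_def)
  show ?thesis
    unfolding Ext_def mrba_cohomology_def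
  proof (rule ex_bij_betw_quotients[where P = "\<lambda>X c. extension_iso (twisted c) X"])
    show "\<exists>c\<in>?Z. extension_iso (twisted c) X" if "X \<in> ?X" for X
      using that by (rule exists_extension_iso_twisted)
  next
    fix c assume c: "c \<in> ?Z"
    then show "\<exists>X\<in>?X. extension_iso (twisted c) X"
      using twisted_in_extensions extension_iso_refl by blast
  next
    fix X Y c d
    assume X: "X \<in> ?X" and Y: "Y \<in> ?X" and c: "c \<in> ?Z" and d: "d \<in> ?Z"
      and cX: "extension_iso (twisted c) X" and dY: "extension_iso (twisted d) Y"
    \<comment> \<open>The isomorphisms \<open>cX\<close> and \<open>dY\<close> are composed on
      either side; \<open>sym\<close> reverses them, since twisted extensions of cocycles are
      abelian extensions.\<close>
    have "extension_iso X Y \<longleftrightarrow> extension_iso (twisted c) (twisted d)"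
    proof
      assume "extension_iso X Y"
      then show "extension_iso (twisted c) (twisted d)"
        using cX sym[OF twisted_in_extensions[OF d] dY] by (blast intro: extension_iso_trans)
    next
      assume "extension_iso (twisted c) (twisted d)"
      then show "extension_iso X Y"
        using dY sym[OF twisted_in_extensions[OF c] cX] by (blast intro: extension_iso_trans)
    qed
    then show "(X, Y) \<in> {(X, Y). X \<in> ?X \<and> Y \<in> ?X \<and> extension_iso X Y} \<longleftrightarrow>
      (c, d) \<in> {(c, c'). c \<in> ?Z \<and> c' \<in> ?Z \<and> c - c' \<in> mrba_coboundaries \<kappa> sA R sM l r S 2}"
      using X Y c d by (simp add: extension_iso_twisted_iff)
  qed auto
qed

end
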